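(* Assume $0<\lambda<\mu^*$, where $\mu^*=B\log_2\bigl(1+\frac{1}{1+\xi_N}\bigr)$. Then the stationary busy probabilities of the two mean-field approximations satisfy $$\pi_\lambda^{MF2}(q>0)\le\pi_\lambda^{MF1}(q>0).$$
   Context: $\mathbb N=\{0,1,2,\dots\}$. Fix an integer $N\ge2$ and constants $B,\lambda>0$. There are $N$ queue positions $1,\dots,N$ on a discrete torus; $d(i,j)=\min(|i-j|,N-|i-j|)$. The path-loss function $l$ is one of $\ell_1(r)=(A\max(r,r_0))^{-C}$, $\ell_2(r)=(1+Ar)^{-C}$, $\ell_3(r)=Ae^{-Cr}$ with $A,C,r_0>0$, and $\xi_N=\sum_{j\ne i}l(d(i,j))$ (independent of $i$). MF1: $\pi_\lambda^{MF1}$ is the law on $\mathbb N$ with mass $(1-x^* )(x^* )^k$ at $k$, where $x^*=x^*(\lambda)$ is the unique solution in $[0,1]$ of $\frac\lambda x=B\log_2\bigl(1+\frac1{1+x\xi_N}\bigr)$; it is the one-queue marginal of the stationary distribution of the first McKean–Vlasov approximation. MF2: for $p\in[0,1]$ let $\nu_p$ be the law of $N-1$ independent Bernoulli($p$) variables. For $\theta=(\theta_m)_{m\ne i}\in\{0,1\}^{N-1}$ let $\mu_i(\theta)=B\log_2\Bigl(1+\frac1{1+\sum_{m\ne i}\theta_m l(d(i,m))}\Bigr)$. Let $A_i$ be a Poisson process of rate $\lambda$ and $D_i^p$ an independent Poisson random measure on $\mathbb R_+\times\mathbb R_+\times\{0,1\}^{N-1}$ with intensity $\mathrm du\,\mathrm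 dz\,\nu_p(\mathrm d\theta)$, and let $q_i^p$ solve $$q_i^p(t)=q_i^p(0)+A_i[0,t]-\int_{\{0,1\}^{N-1}}\int_{\mathbb R_+}\int_0^t\mathbf 1_{\{u\le\mu_i(\theta)\}}\mathbf 1_{\{q_i^p(z^-)>0\}}D_i^p(\mathrm du,\mathrm dz,\mathrm d\theta).$$ When $\lambda<\mu^*$ this queue is stable and has a unique stationary distribution for every $p\in[0,1]$, not depending on $i$ by symmetry. Let $p^\star\in[0,1]$ be any solution of $p^\star=\mathbb P(q^{p^\star}>0)$, the probability being taken in the stationary regime of $q^{p^\star}$ (such a solution exists). The second McKean–Vlasov approximation $q^{MF2}$ is $q^{p^\star}$, and $\pi_\lambda^{MF2}$ is its (one-queue) stationary distribution. *)

theory Defs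
  imports "HOL-Probability.Probability"
begin

subsection \<open>Torus, path loss and service rates\<close>

definition torus_dist :: "nat \<Rightarrow> nat \<Rightarrow> nat \<Rightarrow> real" where
  "torus_dist N i j = min \<bar>real i - real j\<bar> (real N - \<bar>real i - real j\<bar>)"

definition path_loss1 :: "real \<Rightarrow> real \<Rightarrow> real \<Rightarrow> real \<Rightarrow> real" where
  "path_loss1 A C r0 r = (A * max r r0) powr (- C)"

definition path_loss2 :: "real \<Rightarrow> real \<Rightarrow> real \<Rightarrow> real" where
  "path_loss2 A C r = (1 + A * r) powr (- C)"

definition path_loss3 :: "real \<Rightarrow> real \<Rightarrow> real \<Rightarrow> real" where
  "path_loss3 A C r = A * exp (- C * r)"

definition is_path_loss :: "(real \<Rightarrow> real) \<Rightarrow> bool" where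
  "is_path_loss l \<longleftrightarrow> (\<exists>A C r0. A > 0 \<and> C > 0 \<and> r0 > 0 \<and>
     (l = path_loss1 A C r0 \<or> l = path_loss2 A C \<or> l = path_loss3 A C))"

abbreviation others :: "nat \<Rightarrow> nat \<Rightarrow> nat set" where
  "others N i \<equiv> {1..N} - {i}"

definition xi :: "(real \<Rightarrow> real) \<Rightarrow> nat \<Rightarrow> nat \<Rightarrow> real" where
  "xi l N i = (\<Sum>j\<in>others N i. l (torus_dist N i j))"

text \<open>The position argument of \<^const>\<open>xi\<close> is immaterial.\<close>

lemma xi_eq:
  assumes "i \<in> {1..N}"
  shows "xi l N i = (\<Sum>k\<in>{1..<N}. l (min (real k) (real N - real k)))"
  unfolding xi_def
proof (rule sum.reindex_bij_witness[where
      i = "\<lambda>k. if i + k \<le> N then i + k else i + k - N" and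
      j = "\<lambda>j. if i < j then j - i else j + N - i"])
  fix j assume "j \<in> others N i"
  then show "l (min (real (if i < j then j - i else j + N - i))
      (real N - real (if i < j then j - i else j + N - i))) = l (torus_dist N i j)"
    using assms by (cases "i < j") (auto simp: torus_dist_def of_nat_diff algebra_simps min.commute)
qed (use assms in \<open>auto split: if_splits\<close>)

corollary xi_position_independent:
  "i \<in> {1..N} \<Longrightarrow> j \<in> {1..N} \<Longrightarrow> xi l N i = xi l N j"
  by (simp add: xi_eq)

definition mu_star :: "real \<Rightarrow> (real \<Rightarrow> real) \<Rightarrow> nat \<Rightarrow> nat \<Rightarrow> real" where
  "mu_star B l N i = B * log 2 (1 + 1 / (1 + xi l N i))"

definition service_rate ::
  "real \<Rightarrow> (real \<Rightarrow> real) \<Rightarrow> nat \<Rightarrow> nat \<Rightarrow> (nat \<Rightarrow> bool) \<Rightarrow> real" where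
  "service_rate B l N i \<theta> =
     B * log 2 (1 + 1 / (1 + (\<Sum>m\<in>others N i. of_bool (\<theta> m) * l (torus_dist N i m))))"

subsection \<open>First mean-field approximation\<close>

text \<open>
  The division convention \<open>\<lambda> / 0 = 0\<close> creates no spurious root: for \<open>x = 0\<close> the right-hand
  side equals \<open>B > 0\<close>.
\<close>

definition mf1_root :: "real \<Rightarrow> real \<Rightarrow> (real \<Rightarrow> real) \<Rightarrow> nat \<Rightarrow> nat \<Rightarrow> real" where
  "mf1_root lam B l N i =
     (THE x. x \<in> {0..1} \<and> lam / x = B * log 2 (1 + 1 / (1 + x * xi l N i)))"

text \<open>\<^term>\<open>geometric_pmf (1 - x)\<close> has mass \<open>(1 - x) * x ^ k\<close> at \<open>k\<close> for \<open>x \<in> {0..<1}\<close>.\<close>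

definition pi_MF1 :: "real \<Rightarrow> real \<Rightarrow> (real \<Rightarrow> real) \<Rightarrow> nat \<Rightarrow> nat \<Rightarrow> nat pmf" where
  "pi_MF1 lam B l N i = geometric_pmf (1 - mf1_root lam B l N i)"

subsection \<open>Poisson random measures\<close>

text \<open>
  \<open>poisson_random_measure M m R\<close>: on the probability space \<open>M\<close>, \<open>R\<close> is a Poisson random
  measure on the measurable space underlying \<open>m\<close>, with intensity \<open>m\<close>.
\<close>

definition poisson_random_measure ::
  "'w measure \<Rightarrow> 'a measure \<Rightarrow> ('w \<Rightarrow> 'a measure) \<Rightarrow> bool" where
  "poisson_random_measure M m R \<longleftrightarrow>
     (\<forall>\<omega>\<in>space M. sets (R \<omega>) = sets m \<and>
        (\<forall>X\<in>sets m. emeasure (R \<omega>) X \<in> range ennreal_of_enat)) \<and>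
     (\<forall>X\<in>sets m. (\<lambda>\<omega>. emeasure (R \<omega>) X) \<in> borel_measurable M) \<and>
     (\<forall>X\<in>sets m. emeasure m X < \<infinity> \<longrightarrow>
        (\<forall>k::nat. measure M {\<omega>\<in>space M. emeasure (R \<omega>) X = of_nat k} =
           measure m X ^ k / fact k * exp (- measure m X))) \<and>
     (\<forall>X\<in>sets m. emeasure m X = \<infinity> \<longrightarrow> (AE \<omega> in M. emeasure (R \<omega>) X = \<infinity>)) \<and>
     (\<forall>(n::nat) X. X ` {..<n} \<subseteq> sets m \<longrightarrow> disjoint_family_on X {..<n} \<longrightarrow>
        prob_space.indep_vars M (\<lambda>_. borel) (\<lambda>j \<omega>. emeasure (R \<omega>) (X j)) {..<n})"

text \<open>The sigma-algebra on \<open>M\<close> generated by a random measure \<open>R\<close> on the measurable space of \<open>m\<close>.\<close>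

definition random_measure_events ::
  "'w measure \<Rightarrow> 'a measure \<Rightarrow> ('w \<Rightarrow> 'a measure) \<Rightarrow> 'w set set" where
  "random_measure_events M m R = sigma_sets (space M)
     {(\<lambda>\<omega>. emeasure (R \<omega>) X) -` Y \<inter> space M | X Y. X \<in> sets m \<and> Y \<in> sets borel}"

subsection \<open>Second mean-field approximation\<close>

text \<open>The law of \<open>N - 1\<close> independent Bernoulli variables indexed by the positions other than \<open>i\<close>.\<close>

definition bernoulli_field :: "nat \<Rightarrow> nat \<Rightarrow> real \<Rightarrow> (nat \<Rightarrow> bool) measure" where
  "bernoulli_field N i p = (\<Pi>\<^sub>M m\<in>others N i. measure_pmf (bernoulli_pmf p))"

definition half_line :: "real measure" where
  "half_line = restrict_space lborel {0..}"

definition arrival_intensity :: "real \<Rightarrow> real measure" where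
  "arrival_intensity lam = scale_measure (ennreal lam) half_line"

text \<open>The coordinates are \<open>(u, z, \<theta>)\<close>: thinning level, time, activity of the other queues.\<close>

definition departure_intensity ::
  "nat \<Rightarrow> nat \<Rightarrow> real \<Rightarrow> (real \<times> real \<times> (nat \<Rightarrow> bool)) measure" where
  "departure_intensity N i p =
     half_line \<Otimes>\<^sub>M (half_line \<Otimes>\<^sub>M bernoulli_field N i p)"

definition left_lim :: "(real \<Rightarrow> nat) \<Rightarrow> real \<Rightarrow> nat" where
  "left_lim f t = Lim (at_left t) f"

definition cadlag :: "(real \<Rightarrow> nat) \<Rightarrow> bool" where
  "cadlag f \<longleftrightarrow> (\<forall>t\<ge>0. (f \<longlongrightarrow> f t) (at_right t)) \<and> (\<forall>t>0. \<exists>y. (f \<longlongrightarrow> y) (at_left t))"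

text \<open>
  \<open>q t \<omega>\<close> is the queue length at time \<open>t \<ge> 0\<close>; the initial value, the arrivals \<open>A\<close> and the
  potential departures \<open>D\<close> are independent. Time \<open>0\<close>, where \<open>q(0-)\<close> is undefined, is left out
  of the departure integral; almost surely \<open>D\<close> has no relevant atom there. Almost surely the
  integral is over a set of finite \<open>D\<close>-mass.
\<close>

definition mf2_queue ::
  "'w measure \<Rightarrow> real \<Rightarrow> real \<Rightarrow> (real \<Rightarrow> real) \<Rightarrow> nat \<Rightarrow> nat \<Rightarrow> real \<Rightarrow>
   ('w \<Rightarrow> real measure) \<Rightarrow> ('w \<Rightarrow> (real \<times> real \<times> (nat \<Rightarrow> bool)) measure) \<Rightarrow>
   (real \<Rightarrow> 'w \<Rightarrow> nat) \<Rightarrow> bool" where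
  "mf2_queue M lam B l N i p A D q \<longleftrightarrow>
     prob_space M \<and>
     poisson_random_measure M (arrival_intensity lam) A \<and>
     poisson_random_measure M (departure_intensity N i p) D \<and>
     (\<forall>t\<ge>0. q t \<in> measurable M (count_space UNIV)) \<and>
     prob_space.indep_sets M
       (\<lambda>j. [{q 0 -` Y \<inter> space M | Y. Y \<in> UNIV},
              random_measure_events M (arrival_intensity lam) A,
              random_measure_events M (departure_intensity N i p) D] ! j) {..<3} \<and>
     (AE \<omega> in M. cadlag (\<lambda>t. q t \<omega>) \<and>
        (\<forall>t\<ge>0. real (q t \<omega>) = real (q 0 \<omega>) + measure (A \<omega>) {0..t} -
           (\<integral>(u, z, \<theta>). indicator {0<..t} z * indicator {..service_rate B l N i \<theta>} u *
              of_bool (left_lim (\<lambda>s. q s \<omega>) z > 0) \<partial>D \<omega>)))"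

definition stationary_law :: "'w measure \<Rightarrow> (real \<Rightarrow> 'w \<Rightarrow> nat) \<Rightarrow> nat pmf \<Rightarrow> bool" where
  "stationary_law M q \<pi> \<longleftrightarrow> (\<forall>t\<ge>0. distr M (count_space UNIV) (q t) = measure_pmf \<pi>)"

text \<open>
  \<open>\<pi>\<close> is the stationary law of the queue driven with parameter \<open>p\<close>, and \<open>p\<close> is the probability
  that this stationary queue is busy.
\<close>

definition stationary_mf2 ::
  "'w measure \<Rightarrow> real \<Rightarrow> real \<Rightarrow> (real \<Rightarrow> real) \<Rightarrow> nat \<Rightarrow> nat \<Rightarrow> real \<Rightarrow>
   ('w \<Rightarrow> real measure) \<Rightarrow> ('w \<Rightarrow> (real \<times> real \<times> (nat \<Rightarrow> bool)) measure) \<Rightarrow>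
   (real \<Rightarrow> 'w \<Rightarrow> nat) \<Rightarrow> nat pmf \<Rightarrow> bool" where
  "stationary_mf2 M lam B l N i p A D q \<pi> \<longleftrightarrow>
     p \<in> {0..1} \<and> mf2_queue M lam B l N i p A D q \<and> stationary_law M q \<pi> \<and>
     p = measure_pmf.prob \<pi> {k. k > 0}"

end

theory Submission
  imports Defs
begin

text \<open>
  Put \<open>g(s) = B log\<^sub>2 (1 + 1 / (1 + s))\<close>, so that a queue served under interference \<open>s\<close> has rate
  \<open>g(s)\<close>, and let \<open>p\<close> and \<open>x\<close> be the busy probabilities of the second and the first approximation.
  The first one is defined by the balance \<open>x g(x \<xi>) = \<lambda>\<close>. For the second one, work leaves the
  stationary queue at rate \<open>p\<close> times the mean \<open>\<mu>\<close> of \<open>g\<close> over a Bernoulli(\<open>p\<close>) interference,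
  which cannot exceed the arrival rate: \<open>p \<mu> \<le> \<lambda>\<close> (\<open>busy_prob_times_mean_rate_le\<close>). The mean
  interference is \<open>p \<xi>\<close> and \<open>g\<close> is convex, so \<open>g(p \<xi>) \<le> \<mu>\<close> by Jensen's inequality
  (\<open>mean_service_rate_ge\<close>). Hence \<open>p g(p \<xi>) \<le> \<lambda> = x g(x \<xi>)\<close>, and \<open>p \<le> x\<close> because
  \<open>y \<mapsto> y g(y \<xi>)\<close> is strictly increasing (\<open>load_strict_mono\<close>).

  The rate inequality comes from the evolution equation over a short interval \<open>(0, h]\<close>. If the
  queue is busy at time \<open>0\<close> and a potential departure occurs in the interval, then at least one
  customer really leaves (\<open>busy_queue_departs\<close>). So the truncated length \<open>min(q, K)\<close> grows by at
  most the number of arrivals, and by one less on the event that \<open>0 < q(0) \<le> K\<close> and there is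
  exactly one potential departure. Taking expectations, stationarity cancels the truncated lengths
  (which have finite mean, unlike possibly \<open>q\<close> itself), and independence of \<open>q(0)\<close> from the
  departures gives \<open>P(0 < q \<le> K) h \<mu> exp(- h \<mu>) \<le> \<lambda> h\<close>. Then divide by \<open>h\<close> and let
  \<open>h \<rightarrow> 0\<close> and \<open>K \<rightarrow> \<infinity>\<close>.
\<close>

section \<open>Service capacity as a function of the interference\<close>

definition capacity :: "real \<Rightarrow> real \<Rightarrow> real" where
  "capacity B s = B * log 2 (1 + 1 / (1 + s))"

lemma capacity_nonneg: "B \<ge> 0 \<Longrightarrow> s \<ge> 0 \<Longrightarrow> capacity B s \<ge> 0"
  unfolding capacity_def by (intro mult_nonneg_nonneg) (simp_all add: add_pos_nonneg zero_le_log_cancel_iff)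

lemma capacity_le: "B \<ge> 0 \<Longrightarrow> s \<ge> 0 \<Longrightarrow> capacity B s \<le> B"
proof -
  assume "B \<ge> 0" "s \<ge> 0"
  moreover have "log 2 (1 + 1 / (1 + s)) \<le> log 2 2"
    using \<open>s \<ge> 0\<close> by (subst log_le_cancel_iff) (auto simp: add_pos_nonneg divide_simps)
  ultimately show ?thesis
    unfolding capacity_def using mult_left_mono[of "log 2 (1 + 1 / (1 + s))" 1 B] by simp
qed

text \<open>
  Writing the capacity as a difference of logarithms makes both derivatives below elementary.
\<close>

lemma capacity_ln:
  assumes "s > -1"
  shows "capacity B s = B / ln 2 * (ln (2 + s) - ln (1 + s))"
proof -
  have "1 + 1 / (1 + s) = (2 + s) / (1 + s)"
    using assms by (simp add: field_simps)
  then show ?thesis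
    using assms by (simp add: capacity_def log_def ln_div)
qed

lemma convex_capacity:
  assumes "B \<ge> 0"
  shows "convex_on {-1<..} (capacity B)"
proof (rule convex_on_realI)
  fix s :: real assume s: "s \<in> {-1<..}"
  have "((\<lambda>s. B / ln 2 * (ln (2 + s) - ln (1 + s))) has_real_derivative
      - (B / ln 2 * (1 / ((1 + s) * (2 + s))))) (at s)"
    using s by (auto intro!: derivative_eq_intros simp: divide_simps)
  then show "(capacity B has_real_derivative - (B / ln 2 * (1 / ((1 + s) * (2 + s))))) (at s)"
    by (rule DERIV_cong_ev[THEN iffD1, rotated -1])
      (use s in \<open>auto intro!: eventually_mono[OF eventually_nhds_in_open[of "{-1<..}"]] simp: capacity_ln\<close>)
next
  fix s t :: real assume "s \<in> {-1<..}" "t \<in> {-1<..}" "s \<le> t"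
  then have "1 / ((1 + t) * (2 + t)) \<le> 1 / ((1 + s) * (2 + s))"
    by (intro divide_left_mono mult_mono mult_pos_pos) auto
  then show "- (B / ln 2 * (1 / ((1 + s) * (2 + s)))) \<le> - (B / ln 2 * (1 / ((1 + t) * (2 + t))))"
    using assms by (intro le_imp_neg_le mult_left_mono) simp_all
qed auto

text \<open>
  With \<open>s = z c\<close>, the derivative of \<open>z * capacity B (z * c)\<close> is \<open>B / ln 2\<close> times
  \<open>ln (2 + s) - ln (1 + s) - s / ((1 + s) (2 + s))\<close>. The tangent bound \<open>ln y \<le> y - 1\<close> shows that
  the difference of logarithms is at least \<open>1 / (2 + s)\<close>, which exceeds the last term.
\<close>

lemma load_strict_mono:
  assumes "B > 0" "c \<ge> 0" "0 \<le> x" "x < y"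
  shows "x * capacity B (x * c) < y * capacity B (y * c)"
proof (rule DERIV_pos_imp_increasing[OF \<open>x < y\<close>])
  fix z assume "x \<le> z" "z \<le> y"
  define s where "s = z * c"
  have s: "s \<ge> 0" using \<open>x \<le> z\<close> assms by (simp add: s_def)
  have "((\<lambda>z. z * (B / ln 2 * (ln (2 + z * c) - ln (1 + z * c)))) has_real_derivative
      B / ln 2 * ((ln (2 + s) - ln (1 + s)) - s / ((1 + s) * (2 + s)))) (at z)"
  proof -
    have "((\<lambda>z. ln (2 + z * c) - ln (1 + z * c)) has_real_derivative c / (2 + s) - c / (1 + s)) (at z)"
      using s unfolding s_def by (auto intro!: derivative_eq_intros)
    note deriv = DERIV_mult[OF DERIV_ident DERIV_cmult[OF this, of "B / ln 2"]]
    have "z * (c / (2 + s) - c / (1 + s)) = - (s / ((1 + s) * (2 + s)))"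
    proof -
      have "z * (c / (2 + s) - c / (1 + s)) = s / (2 + s) - s / (1 + s)"
        by (simp add: s_def algebra_simps)
      also have "\<dots> = - (s / ((1 + s) * (2 + s)))"
        using s by (simp add: divide_simps) (simp add: algebra_simps)
      finally show ?thesis .
    qed
    moreover have "1 * (k * L) + k * d * z = k * (L - S)" if "z * d = - S" for k L d S
      using that by algebra
    ultimately have "1 * (B / ln 2 * (ln (2 + z * c) - ln (1 + z * c))) +
          B / ln 2 * (c / (2 + s) - c / (1 + s)) * z =
        B / ln 2 * ((ln (2 + s) - ln (1 + s)) - s / ((1 + s) * (2 + s)))"
      unfolding s_def by blast
    with deriv show ?thesis by (rule DERIV_cong)
  qed
  moreover have "\<forall>\<^sub>F w in nhds z. w * c > -1"
    using s by (intro order_tendstoD(1)[of _ "z * c"] tendsto_intros filterlim_ident) (auto simp: s_def)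
  then have "\<forall>\<^sub>F w in nhds z. w * (B / ln 2 * (ln (2 + w * c) - ln (1 + w * c))) = w * capacity B (w * c)"
    by eventually_elim (simp add: capacity_ln)
  ultimately have "((\<lambda>z. z * capacity B (z * c)) has_real_derivative
      B / ln 2 * ((ln (2 + s) - ln (1 + s)) - s / ((1 + s) * (2 + s)))) (at z)"
    by (subst (asm) DERIV_cong_ev[OF refl _ refl])
  moreover have "B / ln 2 * ((ln (2 + s) - ln (1 + s)) - s / ((1 + s) * (2 + s))) > 0"
  proof -
    have "ln (1 + s) - ln (2 + s) = ln ((1 + s) / (2 + s))"
      using s by (simp add: ln_div)
    also have "\<dots> \<le> (1 + s) / (2 + s) - 1"
      using s by (intro ln_le_minus_one) auto
    also have "\<dots> = - 1 / (2 + s)"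
      using s by (simp add: field_simps)
    finally have "1 / (2 + s) \<le> ln (2 + s) - ln (1 + s)" by simp
    moreover have "s / ((1 + s) * (2 + s)) < 1 / (2 + s)"
      using s by (simp add: divide_simps)
    ultimately show ?thesis
      using \<open>B > 0\<close> by simp
  qed
  ultimately show "\<exists>D. ((\<lambda>z. z * capacity B (z * c)) has_real_derivative D) (at z) \<and> D > 0"
    by blast
qed

section \<open>The first approximation\<close>

lemma path_loss_nonneg: "is_path_loss l \<Longrightarrow> l r \<ge> 0"
  by (auto simp: is_path_loss_def path_loss1_def path_loss2_def path_loss3_def)

text \<open>
  The load \<open>y * capacity B (y * \<xi>)\<close> is \<open>0\<close> at \<open>y = 0\<close>, is \<open>\<mu>\<^sup>* > \<lambda>\<close> at \<open>y = 1\<close>, and increases strictly, so the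
  defining equation has exactly one root and this root lies strictly between \<open>0\<close> and \<open>1\<close>. The
  geometric law is then nondegenerate and gives the positive integers exactly the mass of the root.
\<close>

lemma busy_prob_MF1:
  assumes "B > 0" "is_path_loss l" "0 < lam" "lam < mu_star B l N i"
  defines "x \<equiv> measure_pmf.prob (pi_MF1 lam B l N i) {k. k > 0}"
  shows "0 < x" "x * capacity B (x * xi l N i) = lam"
proof -
  let ?c = "xi l N i"
  define h where "h x = x * capacity B (x * ?c)" for x
  have c: "?c \<ge> 0"
    by (simp add: xi_def sum_nonneg path_loss_nonneg[OF assms(2)])
  have mono: "h x < h y" if "0 \<le> x" "x < y" for x y
    unfolding h_def using load_strict_mono[OF assms(1) c that] .
  have pos: "1 + 1 / (1 + y * ?c) > 0" "1 + y * ?c > 0" if "y \<ge> 0" for y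
    using that c by (auto intro!: add_pos_nonneg divide_nonneg_nonneg)
  have "continuous_on {0..1} h"
    unfolding h_def capacity_def
    by (intro continuous_intros) (force dest: pos)+
  moreover have "h 0 \<le> lam" "lam \<le> h 1"
    using assms by (auto simp: h_def mu_star_def capacity_def)
  ultimately obtain y where y: "0 \<le> y" "y \<le> 1" "h y = lam"
    using IVT'[of h 0 lam 1] by auto
  have "y \<noteq> 0" "y \<noteq> 1"
    using y(3) assms(3,4) by (auto simp: h_def mu_star_def capacity_def)
  with y have y01: "0 < y" "y < 1" by auto
  have root: "lam / x = B * log 2 (1 + 1 / (1 + x * ?c)) \<longleftrightarrow> h x = lam" if "x \<in> {0..1}" for x
    using assms(1,3) that by (cases "x = 0") (auto simp: h_def capacity_def field_simps)
  have "mf1_root lam B l N i = y"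
    unfolding mf1_root_def
  proof (rule the_equality)
    show "y \<in> {0..1} \<and> lam / y = B * log 2 (1 + 1 / (1 + y * ?c))"
      using y root by auto
  next
    fix x assume "x \<in> {0..1} \<and> lam / x = B * log 2 (1 + 1 / (1 + x * ?c))"
    then have "x \<ge> 0" "h x = h y" using root y by auto
    with mono[of x y] mono[of y x] y show "x = y"
      by (cases x y rule: linorder_cases) auto
  qed
  moreover have "measure_pmf.prob (geometric_pmf (1 - y)) {k. k > 0} = y"
  proof -
    have "{k::nat. k > 0} = UNIV - {0}" by auto
    then show ?thesis
      using measure_pmf.prob_compl[of "{0}" "geometric_pmf (1 - y)"] y01
      by (simp add: measure_pmf_single)
  qed
  ultimately have "x = y" by (simp add: x_def pi_MF1_def)
  with y01 y(3) show "0 < x" "x * capacity B (x * ?c) = lam"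
    by (auto simp: h_def)
qed

section \<open>Poisson random measures\<close>

lemma poisson_mean_sums: "(\<lambda>k. real k * (x ^ k / fact k * exp (- x))) sums x"
proof -
  have "(\<lambda>k. x ^ k / fact k) sums exp x"
    using exp_converges[of x] by (simp add: divide_inverse mult.commute)
  then have "(\<lambda>k. x ^ k / fact k * (x * exp (- x))) sums (exp x * (x * exp (- x)))"
    by (rule sums_mult2)
  also have "exp x * (x * exp (- x)) = x"
    by (simp add: exp_minus)
  also have "(\<lambda>k. x ^ k / fact k * (x * exp (- x))) =
      (\<lambda>k. real (Suc k) * (x ^ Suc k / fact (Suc k) * exp (- x)))"
    by (simp add: field_simps del: of_nat_Suc)
  finally have "(\<lambda>k. real (Suc k) * (x ^ Suc k / fact (Suc k) * exp (- x))) sums x" .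
  then show ?thesis
    by (subst (asm) sums_Suc_iff) simp
qed

text \<open>
  The real-valued measure sends an infinite mass to \<open>0\<close>; counts have to be split accordingly.
\<close>

lemma enat_valued_measure:
  assumes "emeasure R X \<in> range ennreal_of_enat"
  obtains n :: nat where "emeasure R X = of_nat n" "measure R X = real n"
  | "emeasure R X = \<infinity>" "measure R X = 0"
proof -
  from assms obtain e where e: "emeasure R X = ennreal_of_enat e" by auto
  show ?thesis
  proof (cases e)
    case (enat n)
    with e have "emeasure R X = of_nat n" by simp
    then show ?thesis using that(1) by (simp add: measure_def)
  next
    case infinity
    with e show ?thesis using that(2) by (simp add: measure_def)
  qed
qed

text \<open>
  The real-valued count is \<open>\<Sum>k. k * 1[count = k]\<close>, also where the count is infinite, since both
  sides are \<open>0\<close> there. Integrating termwise gives the mean of the Poisson law.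
\<close>

lemma poisson_random_measure_mean:
  assumes "finite_measure M" and R: "poisson_random_measure M m R"
    and X: "X \<in> sets m" "emeasure m X < \<infinity>"
  shows "(\<integral>\<^sup>+\<omega>. ennreal (measure (R \<omega>) X) \<partial>M) = emeasure m X"
proof -
  interpret finite_measure M by fact
  define E where "E k = {\<omega>\<in>space M. emeasure (R \<omega>) X = of_nat k}" for k :: nat
  have [measurable]: "(\<lambda>\<omega>. emeasure (R \<omega>) X) \<in> borel_measurable M"
    using R X by (auto simp: poisson_random_measure_def)
  have [measurable]: "E k \<in> sets M" for k
    unfolding E_def by measurable
  have pmf: "measure M (E k) = measure m X ^ k / fact k * exp (- measure m X)" for k
    using R X by (simp add: poisson_random_measure_def E_def)
  have "ennreal (measure (R \<omega>) X) = (\<Sum>k. of_nat k * indicator (E k) \<omega>)" if w: "\<omega> \<in> space M" for \<omega>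
  proof -
    have "emeasure (R \<omega>) X \<in> range ennreal_of_enat"
      using R X w by (auto simp: poisson_random_measure_def)
    then show ?thesis
    proof (cases rule: enat_valued_measure)
      case (1 n)
      have "(\<lambda>k. of_nat k * indicator (E k) \<omega> :: ennreal) = (\<lambda>k. if k = n then of_nat k else 0)"
        using w 1 by (auto simp: E_def fun_eq_iff split: split_indicator)
      moreover have "(\<Sum>k. if k = n then of_nat k else 0) = (of_nat n :: ennreal)"
        by (rule sums_unique[symmetric]) (rule sums_single)
      ultimately show ?thesis
        using 1 by (simp only: ennreal_of_nat_eq_real_of_nat)
    next
      case 2
      then have "\<omega> \<notin> E k" for k by (simp add: E_def)
      with 2 show ?thesis by simp
    qed
  qed
  then have "(\<integral>\<^sup>+\<omega>. ennreal (measure (R \<omega>) X) \<partial>M) = (\<integral>\<^sup>+\<omega>. (\<Sum>k. of_nat k * indicator (E k) \<omega>) \<partial>M)"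
    by (intro nn_integral_cong) auto
  also have "\<dots> = (\<Sum>k. of_nat k * emeasure M (E k))"
    by (subst nn_integral_suminf) (auto simp: nn_integral_cmult_indicator)
  also have "\<dots> = (\<Sum>k. ennreal (real k * (measure m X ^ k / fact k * exp (- measure m X))))"
    by (intro suminf_cong, unfold emeasure_eq_measure pmf ennreal_of_nat_eq_real_of_nat)
      (intro ennreal_mult[symmetric], auto)
  also have "\<dots> = ennreal (measure m X)"
    by (intro suminf_ennreal_eq poisson_mean_sums) auto
  finally show ?thesis
    using X by (simp add: emeasure_eq_ennreal_measure)
qed

section \<open>Left limits of integer-valued paths\<close>

lemma left_lim_eq:
  assumes "cadlag f" "t > 0"
  shows "\<forall>\<^sub>F s in at_left t. f s = left_lim f t"
proof -
  obtain y where y: "(f \<longlongrightarrow> y) (at_left t)"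
    using assms by (auto simp: cadlag_def)
  then have "left_lim f t = y"
    unfolding left_lim_def by (intro tendsto_Lim) auto
  with y show ?thesis
    by (simp add: tendsto_discrete)
qed

lemma left_lim_pos:
  assumes "cadlag f" "t > 0" "\<And>s. 0 \<le> s \<Longrightarrow> s < t \<Longrightarrow> f s > 0"
  shows "left_lim f t > 0"
proof -
  have "\<forall>\<^sub>F s in at_left t. 0 \<le> s \<and> s < t"
    using \<open>t > 0\<close> by (auto simp: eventually_at_left[OF \<open>t > 0\<close>] intro!: exI[of _ 0])
  with left_lim_eq[OF assms(1,2)] have "\<forall>\<^sub>F s in at_left t. left_lim f t > 0"
    by eventually_elim (metis assms(3))
  then show ?thesis by simp
qed

text \<open>
  The left limit at \<open>z\<close> is the eventual value of the path along grid points that approach \<open>z\<close>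
  strictly from below. Each grid approximation takes countably many values, so this describes the
  set by countably many measurable conditions.
\<close>

lemma sets_left_lim_pos:
  assumes "cadlag f"
  shows "{z. 0 < z \<and> left_lim f z > 0} \<in> sets borel"
proof -
  \<comment> \<open>the largest multiple of \<open>1 / (n + 1)\<close> strictly below \<open>z\<close>\<close>
  define g where "g n z = (of_int \<lceil>real (Suc n) * z\<rceil> - 1) / real (Suc n)" for n z
  have g: "g n z < z" "z - 1 / real (Suc n) \<le> g n z" for n z
    unfolding g_def by (simp_all add: field_simps del: of_nat_Suc) linarith+
  have g_lim: "filterlim (\<lambda>n. g n z) (at_left z) sequentially" for z
    unfolding filterlim_at
  proof
    have "(\<lambda>n. z - 1 / real (Suc n)) \<longlonglongrightarrow> z - 0"
      by (intro tendsto_diff tendsto_const LIMSEQ_Suc[OF lim_1_over_n])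
    then have lower: "(\<lambda>n. z - 1 / real (Suc n)) \<longlonglongrightarrow> z" by (simp only: diff_zero)
    show "(\<lambda>n. g n z) \<longlonglongrightarrow> z"
      by (rule tendsto_sandwich[OF _ _ lower tendsto_const])
        (intro always_eventually allI g less_imp_le[OF g(1)])+
    show "\<forall>\<^sub>F n in sequentially. g n z \<in> {..<z} \<and> g n z \<noteq> z"
      by (intro always_eventually allI conjI less_imp_neq[OF g(1)]) (simp add: g(1))
  qed
  have "left_lim f z > 0 \<longleftrightarrow> (\<exists>m. \<forall>n. n \<ge> m \<longrightarrow> f (g n z) > 0)" if "z > 0" for z
  proof -
    have "\<forall>\<^sub>F n in sequentially. f (g n z) = left_lim f z"
      using left_lim_eq[OF assms that] g_lim by (rule eventually_compose_filterlim)
    then obtain m where m: "\<And>n. n \<ge> m \<Longrightarrow> f (g n z) = left_lim f z"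
      by (auto simp: eventually_sequentially)
    show ?thesis
      using m by (metis linorder_linear)
  qed
  then have "{z. 0 < z \<and> left_lim f z > 0} = {z. 0 < z \<and> (\<exists>m. \<forall>n. n \<ge> m \<longrightarrow> f (g n z) > 0)}"
    by auto
  also have "\<dots> \<in> sets borel"
  proof -
    have [measurable]: "(\<lambda>z. f (g n z)) \<in> measurable borel (count_space UNIV)" for n
      unfolding g_def by measurable
    show ?thesis by measurable
  qed
  finally show ?thesis .
qed

section \<open>Potential departures\<close>

text \<open>
  An atom at one of these points removes a customer during \<open>{0<..t}\<close> if the queue is not empty just before. The
  condition \<open>u \<ge> 0\<close> keeps the set inside the half-line that carries the intensity.
\<close>

definition potential_departures ::
  "('b \<Rightarrow> real) \<Rightarrow> real \<Rightarrow> 'b measure \<Rightarrow> (real \<times> real \<times> 'b) set" where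
  "potential_departures mu t T =
     {(u, z, \<theta>). u \<ge> 0 \<and> u \<le> mu \<theta> \<and> 0 < z \<and> z \<le> t \<and> \<theta> \<in> space T}"

lemma measurable_half_line_ident [measurable]: "(\<lambda>x. x) \<in> borel_measurable half_line"
  unfolding half_line_def by (intro measurable_restrict_space1) simp

lemma space_half_line [simp]: "space half_line = {0..}"
  by (simp add: half_line_def space_restrict_space)

lemma sets_potential_departures:
  assumes [measurable]: "mu \<in> borel_measurable T" "{z. 0 < z \<and> P z} \<in> sets borel"
  shows "{(u, z, \<theta>) \<in> potential_departures mu t T. P z} \<in> sets (half_line \<Otimes>\<^sub>M (half_line \<Otimes>\<^sub>M T))"
    (is "?L \<in> sets ?M")
proof -
  have [measurable]: "fst \<in> borel_measurable ?M"
    using measurable_compose[OF measurable_fst measurable_half_line_ident] by (simp add: comp_def)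
  have [measurable]: "(\<lambda>w. fst (snd w)) \<in> borel_measurable ?M"
    using measurable_compose[OF measurable_compose[OF measurable_snd measurable_fst] measurable_half_line_ident] by simp
  have [measurable]: "(\<lambda>w. mu (snd (snd w))) \<in> borel_measurable ?M"
    by (intro measurable_compose[OF measurable_compose[OF measurable_snd measurable_snd] assms(1)])
  have "?L = {w \<in> space ?M. fst w \<le> mu (snd (snd w)) \<and> fst (snd w) \<le> t \<and> fst (snd w) \<in> {z. 0 < z \<and> P z}}"
    by (auto simp: potential_departures_def space_pair_measure)
  also have "\<dots> \<in> sets ?M" by measurable
  finally show ?thesis .
qed

text \<open>
  Suppose that no customer left by time \<open>h\<close>. Then the queue only grew from its positive initial
  value, so it was never empty before \<open>h\<close>, and every potential departure was a real one. This
  contradicts the presence of a potential departure. As departures are counted in integers, at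
  least one took place. The finiteness of the count matters: the departure integral of an infinite
  mass would be \<open>0\<close>.
\<close>

lemma busy_queue_departs:
  fixes f :: "real \<Rightarrow> nat" and D :: "(real \<times> real \<times> 'b) measure" and mu :: "'b \<Rightarrow> real"
  assumes sets_D: "sets D = sets (half_line \<Otimes>\<^sub>M (half_line \<Otimes>\<^sub>M T))"
    and mu: "mu \<in> borel_measurable T"
    and count: "\<And>X. X \<in> sets D \<Longrightarrow> emeasure D X \<in> range ennreal_of_enat"
    and f: "cadlag f" "\<And>t. t \<ge> 0 \<Longrightarrow> real (f t) = real (f 0) + a t -
      (\<integral>(u, z, \<theta>). indicator {0<..t} z * indicator {..mu \<theta>} u * of_bool (left_lim f z > 0) \<partial>D)"
    and a: "\<And>t. t \<ge> 0 \<Longrightarrow> a t \<ge> 0"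
    and h: "h > 0" "emeasure D (potential_departures mu h T) \<notin> {0, \<infinity>}"
    and "f 0 > 0"
  shows "real (f h) \<le> real (f 0) + a h - 1"
proof -
  let ?X = "potential_departures mu h T"
  \<comment> \<open>the departures that really take place up to time \<open>t\<close>\<close>
  define Y where "Y t = {(u, z, \<theta>) \<in> potential_departures mu t T. left_lim f z > 0}" for t
  have space_D: "space D = {0..} \<times> {0..} \<times> space T"
    using sets_eq_imp_space_eq[OF sets_D] by (simp add: space_pair_measure)
  have X: "?X \<in> sets D"
    using sets_potential_departures[OF mu, of "\<lambda>_. True" h] sets_D by simp
  have Y: "Y t \<in> sets D" for t
    unfolding Y_def sets_D by (intro sets_potential_departures mu sets_left_lim_pos f)
  have served: "real (f t) = real (f 0) + a t - measure D (Y t)" if "t \<ge> 0" for t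
  proof -
    have "(\<integral>(u, z, \<theta>). indicator {0<..t} z * indicator {..mu \<theta>} u * of_bool (left_lim f z > 0) \<partial>D) =
        (\<integral>w. indicator (Y t) w \<partial>D :: real)"
      by (intro Bochner_Integration.integral_cong)
        (auto simp: Y_def potential_departures_def space_D indicator_def)
    also have "\<dots> = measure D (Y t)"
      using sets.sets_into_space[OF Y[of t]] by (simp add: Int_absorb2)
    finally show ?thesis
      using f(2)[OF that] by simp
  qed
  have Y_X: "Y h \<subseteq> ?X" by (auto simp: Y_def)
  have Y_fin: "emeasure D (Y h) < \<infinity>"
    by (rule le_less_trans[OF emeasure_mono[OF Y_X X]]) (use h(2) in \<open>simp add: less_top[symmetric]\<close>)
  have "measure D (Y h) \<noteq> 0"
  proof
    assume 0: "measure D (Y h) = 0"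
    have pos: "f t > 0" if "0 \<le> t" "t \<le> h" for t
    proof -
      have "measure D (Y t) \<le> measure D (Y h)"
        using that Y Y_fin
        by (intro measure_mono_fmeasurable) (auto simp: fmeasurable_def Y_def potential_departures_def)
      with 0 have "measure D (Y t) = 0" by (simp add: measure_le_0_iff)
      with served[of t] a[of t] that \<open>f 0 > 0\<close> show ?thesis by simp
    qed
    have "left_lim f z > 0" if "0 < z" "z \<le> h" for z
      using that by (intro left_lim_pos f pos) auto
    then have "Y h = ?X" by (auto simp: Y_def potential_departures_def)
    with 0 h(2) Y_fin show False
      by (simp add: measure_def enn2real_eq_0_iff)
  qed
  from count[OF Y[of h]] have "measure D (Y h) \<ge> 1"
    by (rule enat_valued_measure) (use \<open>measure D (Y h) \<noteq> 0\<close> in auto)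
  with served[of h] h(1) show ?thesis
    by simp
qed

lemma sigma_finite_half_line: "sigma_finite_measure half_line"
  unfolding half_line_def
  by (intro sigma_finite_measure_restrict_space sigma_finite_lborel) simp

lemma emeasure_half_line:
  "X \<in> sets borel \<Longrightarrow> X \<subseteq> {0..} \<Longrightarrow> emeasure half_line X = emeasure lborel X"
  unfolding half_line_def by (subst emeasure_restrict_space) auto

text \<open>
  For fixed \<open>z\<close> and \<open>\<theta>\<close>, the admissible levels form the interval \<open>[0, mu \<theta>]\<close> of length \<open>mu \<theta>\<close>.
  The bound \<open>c\<close> is there to make \<open>mu\<close> integrable.
\<close>

lemma emeasure_potential_departures:
  assumes "prob_space T" and mu: "mu \<in> borel_measurable T" "\<And>\<theta>. 0 \<le> mu \<theta>" "\<And>\<theta>. mu \<theta> \<le> c"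
    and "h \<ge> 0"
  shows "emeasure (half_line \<Otimes>\<^sub>M (half_line \<Otimes>\<^sub>M T)) (potential_departures mu h T) =
    ennreal (h * (\<integral>\<theta>. mu \<theta> \<partial>T))"
proof -
  interpret T: prob_space T by fact
  interpret H: sigma_finite_measure half_line by (rule sigma_finite_half_line)
  interpret HT: pair_sigma_finite half_line T ..
  interpret P: pair_sigma_finite half_line "half_line \<Otimes>\<^sub>M T" ..
  have [measurable]: "potential_departures mu h T \<in> sets (half_line \<Otimes>\<^sub>M (half_line \<Otimes>\<^sub>M T))"
    using sets_potential_departures[OF mu(1), of "\<lambda>_. True" h] by simp
  note [measurable] = mu(1)
  have interval: "{0<..h} \<in> sets half_line"
    by (auto simp: half_line_def sets_restrict_space_iff)
  have "emeasure (half_line \<Otimes>\<^sub>M (half_line \<Otimes>\<^sub>M T)) (potential_departures mu h T) =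
      (\<integral>\<^sup>+y. emeasure half_line ((\<lambda>x. (x, y)) -` potential_departures mu h T) \<partial>(half_line \<Otimes>\<^sub>M T))"
    by (rule P.emeasure_pair_measure_alt2) measurable
  also have "\<dots> = (\<integral>\<^sup>+y. indicator {0<..h} (fst y) * ennreal (mu (snd y)) \<partial>(half_line \<Otimes>\<^sub>M T))"
  proof (rule nn_integral_cong)
    fix y assume "y \<in> space (half_line \<Otimes>\<^sub>M T)"
    then have "(\<lambda>x. (x, y)) -` potential_departures mu h T = (if fst y \<in> {0<..h} then {0..mu (snd y)} else {})"
      by (auto simp: potential_departures_def space_pair_measure)
    then show "emeasure half_line ((\<lambda>x. (x, y)) -` potential_departures mu h T) =
        indicator {0<..h} (fst y) * ennreal (mu (snd y))"
      by (simp add: emeasure_half_line mu(2))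
  qed
  also have "\<dots> = (\<integral>\<^sup>+z. (\<integral>\<^sup>+\<theta>. indicator {0<..h} z * ennreal (mu \<theta>) \<partial>T) \<partial>half_line)"
  proof -
    have "(\<lambda>y. indicator {0<..h} (fst y) * ennreal (mu (snd y))) \<in> borel_measurable (half_line \<Otimes>\<^sub>M T)"
      by (intro borel_measurable_times_ennreal
          measurable_compose[OF measurable_fst borel_measurable_indicator[OF interval]]
          measurable_compose[OF measurable_snd measurable_compose[OF mu(1) measurable_ennreal]])
    then show ?thesis
      by (subst T.nn_integral_fst[symmetric]) simp_all
  qed
  also have "\<dots> = (\<integral>\<^sup>+z. indicator {0<..h} z * ennreal (\<integral>\<theta>. mu \<theta> \<partial>T) \<partial>half_line)"
  proof -
    have "integrable T mu"
      using mu by (intro T.integrable_const_bound[of _ c]) auto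
    then have "(\<integral>\<^sup>+\<theta>. ennreal (mu \<theta>) \<partial>T) = ennreal (\<integral>\<theta>. mu \<theta> \<partial>T)"
      using mu(2) by (intro nn_integral_eq_integral) auto
    then show ?thesis
      by (simp add: nn_integral_cmult)
  qed
  also have "\<dots> = ennreal h * ennreal (\<integral>\<theta>. mu \<theta> \<partial>T)"
  proof -
    have "emeasure half_line {0<..h} = ennreal h"
      using \<open>h \<ge> 0\<close> by (subst emeasure_half_line) auto
    then show ?thesis
      using interval by (subst nn_integral_multc) auto
  qed
  finally show ?thesis
    using \<open>h \<ge> 0\<close> mu(2) by (simp add: ennreal_mult Bochner_Integration.integral_nonneg)
qed

section \<open>The mean service rate\<close>

lemma prob_space_bernoulli_field: "prob_space (bernoulli_field N i p)"
  unfolding bernoulli_field_def by (intro prob_space_PiM measure_pmf.prob_space_axioms)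

lemma measurable_bernoulli_field_component [measurable]:
  "m \<in> others N i \<Longrightarrow> (\<lambda>\<theta>. \<theta> m) \<in> measurable (bernoulli_field N i p) (count_space UNIV)"
  using measurable_component_singleton[of m "others N i" "\<lambda>_. measure_pmf (bernoulli_pmf p)"]
  by (simp add: bernoulli_field_def)

lemma measurable_interference [measurable]:
  "(\<lambda>\<theta>. \<Sum>m\<in>others N i. of_bool (\<theta> m) * l (torus_dist N i m)) \<in> borel_measurable (bernoulli_field N i p)"
  for l :: "real \<Rightarrow> real"
proof (intro borel_measurable_sum borel_measurable_times borel_measurable_const)
  fix m assume "m \<in> others N i"
  then show "(\<lambda>\<theta>. of_bool (\<theta> m) :: real) \<in> borel_measurable (bernoulli_field N i p)"
    by (intro measurable_compose[OF measurable_bernoulli_field_component]) auto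
qed

lemma expectation_interference:
  assumes "p \<in> {0..1}"
  shows "(\<integral>\<theta>. (\<Sum>m\<in>others N i. of_bool (\<theta> m) * l (torus_dist N i m)) \<partial>bernoulli_field N i p) = p * xi l N i"
proof -
  interpret prob_space "bernoulli_field N i p" by (rule prob_space_bernoulli_field)
  have *: "(\<integral>\<theta>. (of_bool (\<theta> m) :: real) \<partial>bernoulli_field N i p) = p" if m: "m \<in> others N i" for m
  proof -
    let ?B = "\<lambda>_. measure_pmf (bernoulli_pmf p)"
    have "(\<integral>\<theta>. (of_bool (\<theta> m) :: real) \<partial>bernoulli_field N i p) =
        (\<integral>b. of_bool b \<partial>distr (Pi\<^sub>M (others N i) ?B) (?B m) (\<lambda>\<theta>. \<theta> m))"
      unfolding bernoulli_field_def
      by (rule integral_distr[symmetric]) (rule measurable_component_singleton[OF m], simp)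
    also have "\<dots> = (\<integral>b. of_bool b \<partial>measure_pmf (bernoulli_pmf p))"
      using m by (subst distr_PiM_component) (auto intro: measure_pmf.prob_space_axioms)
    also have "\<dots> = p"
      using assms by simp
    finally show ?thesis .
  qed
  have "integrable (bernoulli_field N i p) (\<lambda>\<theta>. of_bool (\<theta> m) :: real)" if "m \<in> others N i" for m
    using that by (intro integrable_const_bound[of _ 1] AE_I2 measurable_compose[OF measurable_bernoulli_field_component]) auto
  then show ?thesis
    by (subst Bochner_Integration.integral_sum) (auto simp: * xi_def sum_distrib_left)
qed

lemma service_rate_capacity:
  "service_rate B l N i \<theta> = capacity B (\<Sum>m\<in>others N i. of_bool (\<theta> m) * l (torus_dist N i m))"
  by (simp add: service_rate_def capacity_def)

lemma service_rate_bounds: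
  assumes "B \<ge> 0" "is_path_loss l"
  shows "0 \<le> service_rate B l N i \<theta>" "service_rate B l N i \<theta> \<le> B"
  unfolding service_rate_capacity
  by (intro capacity_nonneg capacity_le sum_nonneg mult_nonneg_nonneg
      path_loss_nonneg[OF assms(2)] assms(1); simp)+

lemma measurable_service_rate [measurable]:
  "service_rate B l N i \<in> borel_measurable (bernoulli_field N i p)"
  unfolding service_rate_def by measurable

text \<open>
  Jensen's inequality for the convex capacity: random interference yields a better mean service
  than constant interference of the same mean.
\<close>

lemma mean_service_rate_ge:
  assumes "B \<ge> 0" "is_path_loss l" "p \<in> {0..1}"
  shows "capacity B (p * xi l N i) \<le> (\<integral>\<theta>. service_rate B l N i \<theta> \<partial>bernoulli_field N i p)"
proof -
  interpret prob_space "bernoulli_field N i p" by (rule prob_space_bernoulli_field)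
  let ?S = "\<lambda>\<theta>. \<Sum>m\<in>others N i. of_bool (\<theta> m) * l (torus_dist N i m)"
  have S: "0 \<le> ?S \<theta>" "?S \<theta> \<le> xi l N i" for \<theta>
    unfolding xi_def
    by (intro sum_nonneg sum_mono mult_nonneg_nonneg mult_left_le_one_le path_loss_nonneg[OF assms(2)]; simp)+
  have "capacity B (expectation ?S) \<le> expectation (\<lambda>\<theta>. capacity B (?S \<theta>))"
  proof (rule jensens_inequality[where I = "{-1<..}" and a = "-1"])
    show "integrable (bernoulli_field N i p) ?S"
    proof (rule integrable_const_bound)
      show "AE \<theta> in bernoulli_field N i p. norm (?S \<theta>) \<le> xi l N i"
        using S by (intro AE_I2) (simp only: real_norm_def abs_of_nonneg)
    qed (rule measurable_interference)
    show "AE \<theta> in bernoulli_field N i p. ?S \<theta> \<in> {-1<..}"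
      using S(1) by (intro AE_I2) (simp add: less_le_trans[of _ 0])
    show "integrable (bernoulli_field N i p) (\<lambda>\<theta>. capacity B (?S \<theta>))"
      unfolding service_rate_capacity[symmetric]
      using service_rate_bounds[OF assms(1,2)] by (intro integrable_const_bound[of _ B]) auto
  qed (use convex_capacity assms in auto)
  then show ?thesis
    unfolding expectation_interference[OF assms(3)] service_rate_capacity .
qed

section \<open>Balance of arrivals and departures in the stationary regime\<close>

lemma emeasure_arrival_intensity:
  "h \<ge> 0 \<Longrightarrow> lam \<ge> 0 \<Longrightarrow> emeasure (arrival_intensity lam) {0..h} = ennreal (lam * h)"
  by (simp add: arrival_intensity_def emeasure_half_line ennreal_mult)

lemma stationary_expectation:
  assumes "stationary_law M q \<pi>" "t \<ge> 0" and q: "q t \<in> measurable M (count_space UNIV)"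
  shows "(\<integral>\<^sup>+\<omega>. g (q t \<omega>) \<partial>M) = (\<integral>\<^sup>+k. g k \<partial>measure_pmf \<pi>)"
proof -
  have "measure_pmf \<pi> = distr M (count_space UNIV) (q t)"
    using assms by (simp add: stationary_law_def)
  then show ?thesis
    using q by (simp add: nn_integral_distr)
qed

text \<open>
  \<open>h * mu * exp (- (h * mu))\<close> is the probability of exactly one potential departure by time \<open>h\<close>.
  Restricting to exactly one loses only a term of order \<open>h\<^sup>2\<close> and excludes infinite counts.
\<close>

lemma busy_prob_times_service_bound:
  assumes "B \<ge> 0" "is_path_loss l" "lam \<ge> 0"
    and queue: "mf2_queue M lam B l N i p A D q" and stat: "stationary_law M q \<pi>"
    and h: "h > 0"
  defines "mu \<equiv> \<integral>\<theta>. service_rate B l N i \<theta> \<partial>bernoulli_field N i p"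
  shows "measure_pmf.prob \<pi> {0<..K} * (h * mu * exp (- (h * mu))) \<le> lam * h"
proof -
  interpret prob_space M using queue by (simp add: mf2_queue_def)
  let ?T = "bernoulli_field N i p" and ?mu = "service_rate B l N i"
  let ?X = "potential_departures ?mu h ?T"
  note rate = service_rate_bounds[OF assms(1,2)]
  have A: "poisson_random_measure M (arrival_intensity lam) A"
    and D: "poisson_random_measure M (departure_intensity N i p) D"
    and q [measurable]: "\<And>t. t \<ge> 0 \<Longrightarrow> q t \<in> measurable M (count_space UNIV)"
    using queue by (auto simp: mf2_queue_def)
  have mu_nonneg: "mu \<ge> 0"
    unfolding mu_def by (intro Bochner_Integration.integral_nonneg rate)
  have X: "?X \<in> sets (departure_intensity N i p)"
    using sets_potential_departures[OF measurable_service_rate[of B l N i p], of "\<lambda>_. True" h]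
    by (simp add: departure_intensity_def)
  have X_mass: "emeasure (departure_intensity N i p) ?X = ennreal (h * mu)"
    using emeasure_potential_departures[OF prob_space_bernoulli_field measurable_service_rate rate] h
    by (simp add: departure_intensity_def mu_def)
  have [measurable]: "(\<lambda>\<omega>. emeasure (D \<omega>) ?X) \<in> borel_measurable M"
    using D X by (simp add: poisson_random_measure_def)
  define Q where "Q = q 0 -` {0<..K} \<inter> space M"
  define E where "E = (\<lambda>\<omega>. emeasure (D \<omega>) ?X) -` {1} \<inter> space M"
  have [measurable]: "Q \<in> events"
    unfolding Q_def by (rule measurable_sets[OF q]) auto
  have [measurable]: "E \<in> events"
    unfolding E_def by measurable
  have prob_Q: "prob Q = measure_pmf.prob \<pi> {0<..K}"
  proof -
    have "measure (distr M (count_space UNIV) (q 0)) {0<..K} = prob Q"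
      unfolding Q_def by (rule measure_distr) (auto intro: q)
    then show ?thesis
      using stat by (simp add: stationary_law_def)
  qed
  have prob_E: "prob E = h * mu * exp (- (h * mu))"
  proof -
    have "E = {\<omega>\<in>space M. emeasure (D \<omega>) ?X = of_nat 1}"
      by (auto simp: E_def)
    moreover have "emeasure (departure_intensity N i p) ?X < \<infinity>"
      by (simp add: X_mass)
    then have "prob {\<omega>\<in>space M. emeasure (D \<omega>) ?X = of_nat 1} =
        measure (departure_intensity N i p) ?X ^ 1 / fact 1 * exp (- measure (departure_intensity N i p) ?X)"
      using D X unfolding poisson_random_measure_def by blast
    moreover have "measure (departure_intensity N i p) ?X = h * mu"
      using X_mass h mu_nonneg by (simp add: measure_def)
    ultimately show ?thesis by simp
  qed
  have "prob (Q \<inter> E) = prob Q * prob E"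
  proof -
    let ?F = "\<lambda>j. [{q 0 -` Y \<inter> space M | Y. Y \<in> UNIV},
              random_measure_events M (arrival_intensity lam) A,
              random_measure_events M (departure_intensity N i p) D] ! j"
    have "indep_sets ?F {..<3}"
      using queue by (simp add: mf2_queue_def)
    moreover have "Q \<in> ?F 0" "E \<in> ?F 2"
      using X by (auto simp: Q_def E_def random_measure_events_def intro!: sigma_sets.Basic exI)
    ultimately have "prob (\<Inter>j\<in>{0, 2::nat}. if j = 0 then Q else E) = (\<Prod>j\<in>{0, 2::nat}. prob (if j = 0 then Q else E))"
      by (intro indep_setsD[of ?F "{..<3}"]) auto
    then show ?thesis by (simp add: Int_commute)
  qed
  \<comment> \<open>growth of the truncated queue: at most the arrivals, and one less on \<open>Q \<inter> E\<close>\<close>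
  have path: "AE \<omega> in M. ennreal (min (q h \<omega>) K) + indicator (Q \<inter> E) \<omega> \<le>
      ennreal (min (q 0 \<omega>) K) + ennreal (measure (A \<omega>) {0..h})"
  proof -
    have "AE \<omega> in M. cadlag (\<lambda>t. q t \<omega>) \<and>
        (\<forall>t\<ge>0. real (q t \<omega>) = real (q 0 \<omega>) + measure (A \<omega>) {0..t} -
           (\<integral>(u, z, \<theta>). indicator {0<..t} z * indicator {..?mu \<theta>} u *
              of_bool (left_lim (\<lambda>s. q s \<omega>) z > 0) \<partial>D \<omega>))"
      using queue unfolding mf2_queue_def by (elim conjE) assumption
    with AE_space show ?thesis
    proof eventually_elim
      case (elim \<omega>)
      then have w: "\<omega> \<in> space M" and cadlag: "cadlag (\<lambda>t. q t \<omega>)"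
        and eq: "\<forall>t\<ge>0. real (q t \<omega>) = real (q 0 \<omega>) + measure (A \<omega>) {0..t} -
           (\<integral>(u, z, \<theta>). indicator {0<..t} z * indicator {..?mu \<theta>} u *
              of_bool (left_lim (\<lambda>s. q s \<omega>) z > 0) \<partial>D \<omega>)"
        by blast+
      have arrived: "real (q h \<omega>) \<le> real (q 0 \<omega>) + measure (A \<omega>) {0..h}"
      proof -
        have "0 \<le> (\<integral>(u, z, \<theta>). indicator {0<..h} z * indicator {..?mu \<theta>} u *
              of_bool (left_lim (\<lambda>s. q s \<omega>) z > 0) \<partial>D \<omega> :: real)"
          by (intro Bochner_Integration.integral_nonneg) auto
        with eq[rule_format, OF less_imp_le[OF h]] show ?thesis by linarith
      qed
      have served: "real (q h \<omega>) \<le> real (q 0 \<omega>) + measure (A \<omega>) {0..h} - 1" if "\<omega> \<in> Q \<inter> E"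
      proof (rule busy_queue_departs[where f = "\<lambda>t. q t \<omega>" and T = ?T and mu = ?mu and D = "D \<omega>"])
        show "sets (D \<omega>) = sets (half_line \<Otimes>\<^sub>M (half_line \<Otimes>\<^sub>M ?T))"
          using D w by (simp add: poisson_random_measure_def departure_intensity_def)
        then show "emeasure (D \<omega>) Y \<in> range ennreal_of_enat" if "Y \<in> sets (D \<omega>)" for Y
          using D w that by (simp add: poisson_random_measure_def departure_intensity_def)
        show "real (q t \<omega>) = real (q 0 \<omega>) + measure (A \<omega>) {0..t} -
            (\<integral>(u, z, \<theta>). indicator {0<..t} z * indicator {..?mu \<theta>} u *
              of_bool (left_lim (\<lambda>s. q s \<omega>) z > 0) \<partial>D \<omega>)" if "t \<ge> 0" for t
          using that by (rule eq[rule_format])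
        show "emeasure (D \<omega>) ?X \<notin> {0, \<infinity>}" "q 0 \<omega> > 0"
          using \<open>\<omega> \<in> Q \<inter> E\<close> by (auto simp: Q_def E_def)
      qed (rule measurable_service_rate cadlag measure_nonneg h)+
      have "real (min (q h \<omega>) K) + indicator (Q \<inter> E) \<omega> \<le>
          real (min (q 0 \<omega>) K) + measure (A \<omega>) {0..h}"
      proof (cases "\<omega> \<in> Q \<inter> E")
        case True
        \<comment> \<open>the truncation does not hide the departure, because \<open>q 0\<close> itself is not truncated\<close>
        then have "q 0 \<omega> \<le> K" by (simp add: Q_def)
        with True served show ?thesis
          by (simp add: of_nat_min)
      next
        case False
        with arrived measure_nonneg[of "A \<omega>" "{0..h}"] show ?thesis
          by (auto simp: of_nat_min min_def intro: add_increasing2)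
      qed
      then have "ennreal (real (min (q h \<omega>) K) + indicator (Q \<inter> E) \<omega>) \<le>
          ennreal (real (min (q 0 \<omega>) K) + measure (A \<omega>) {0..h})"
        by (rule ennreal_leI)
      then show ?case
        by (subst (asm) (1 2) ennreal_plus) (simp_all only: ennreal_indicator of_nat_0_le_iff
            indicator_pos_le measure_nonneg)
    qed
  qed
  \<comment> \<open>by stationarity the truncated mean is the same at both times; it is finite, so it cancels\<close>
  define c where "c = (\<integral>\<^sup>+k. ennreal (real (min k K)) \<partial>measure_pmf \<pi>)"
  have c: "(\<integral>\<^sup>+\<omega>. ennreal (min (q t \<omega>) K) \<partial>M) = c" if "t \<ge> 0" for t
    unfolding c_def using stationary_expectation[OF stat that q[OF that], of "\<lambda>k. ennreal (real (min k K))"] .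
  have "c \<le> (\<integral>\<^sup>+k. ennreal (real K) \<partial>measure_pmf \<pi>)"
    unfolding c_def by (intro nn_integral_mono ennreal_leI) simp
  then have c_fin: "c \<noteq> \<top>"
    by (auto simp: measure_pmf.emeasure_space_1 top_unique)
  have arr_set: "{0..h} \<in> sets (arrival_intensity lam)"
    by (auto simp: arrival_intensity_def half_line_def sets_restrict_space_iff)
  have arr: "(\<integral>\<^sup>+\<omega>. ennreal (measure (A \<omega>) {0..h}) \<partial>M) = ennreal (lam * h)"
    using poisson_random_measure_mean[OF finite_measure_axioms A arr_set]
      emeasure_arrival_intensity[of h lam] h assms(3) by simp
  have [measurable]: "(\<lambda>\<omega>. measure (A \<omega>) {0..h}) \<in> borel_measurable M"
  proof -
    have "(\<lambda>\<omega>. emeasure (A \<omega>) {0..h}) \<in> borel_measurable M"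
      using A arr_set by (simp add: poisson_random_measure_def)
    then show ?thesis unfolding measure_def by measurable
  qed
  have [measurable]: "(\<lambda>\<omega>. ennreal (min (q t \<omega>) K)) \<in> borel_measurable M" if "t \<ge> 0" for t
    using measurable_compose[OF q[OF that], of "\<lambda>k. ennreal (real (min k K))" borel] by simp
  have "c + ennreal (prob Q * prob E) =
      (\<integral>\<^sup>+\<omega>. ennreal (min (q h \<omega>) K) + indicator (Q \<inter> E) \<omega> \<partial>M)"
    using h by (subst nn_integral_add) (auto simp: c emeasure_eq_measure \<open>prob (Q \<inter> E) = _\<close>)
  also have "\<dots> \<le> (\<integral>\<^sup>+\<omega>. ennreal (min (q 0 \<omega>) K) + ennreal (measure (A \<omega>) {0..h}) \<partial>M)"
    by (rule nn_integral_mono_AE) (rule path)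
  also have "\<dots> = c + ennreal (lam * h)"
    by (subst nn_integral_add) (auto simp: c arr)
  finally have "ennreal (prob Q * prob E) \<le> ennreal (lam * h)"
    using c_fin by (simp add: ennreal_add_left_cancel_le)
  then show ?thesis
    using h assms(3) by (simp add: prob_Q prob_E)
qed

lemma busy_prob_times_mean_rate_le:
  assumes "B \<ge> 0" "is_path_loss l" "lam \<ge> 0"
    and "mf2_queue M lam B l N i p A D q" "stationary_law M q \<pi>"
  shows "measure_pmf.prob \<pi> {k. k > 0} * (\<integral>\<theta>. service_rate B l N i \<theta> \<partial>bernoulli_field N i p) \<le> lam"
proof -
  let ?mu = "\<integral>\<theta>. service_rate B l N i \<theta> \<partial>bernoulli_field N i p"
  have le: "measure_pmf.prob \<pi> {0<..K} * ?mu \<le> lam" for K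
  proof (rule tendsto_upperbound)
    \<comment> \<open>divide the previous bound by \<open>h\<close> and let \<open>h\<close> tend to \<open>0\<close>\<close>
    show "((\<lambda>h. measure_pmf.prob \<pi> {0<..K} * (?mu * exp (- (h * ?mu)))) \<longlongrightarrow> measure_pmf.prob \<pi> {0<..K} * ?mu) (at_right 0)"
      by (rule tendsto_eq_intros refl | simp)+
    show "\<forall>\<^sub>F h in at_right 0. measure_pmf.prob \<pi> {0<..K} * (?mu * exp (- (h * ?mu))) \<le> lam"
      using eventually_at_right_less[of "0::real"]
    proof eventually_elim
      case (elim h)
      with busy_prob_times_service_bound[OF assms elim, of K] show ?case
        by (simp add: field_simps)
    qed
  qed auto
  have "(\<lambda>K. measure_pmf.prob \<pi> {0<..K}) \<longlonglongrightarrow> measure_pmf.prob \<pi> (\<Union>K. {0<..K})"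
    by (intro measure_pmf.finite_Lim_measure_incseq) (auto simp: incseq_def)
  moreover have "(\<Union>K::nat. {0<..K}) = {k. k > 0}" by auto
  ultimately have "(\<lambda>K. measure_pmf.prob \<pi> {0<..K} * ?mu) \<longlonglongrightarrow> measure_pmf.prob \<pi> {k. k > 0} * ?mu"
    by (intro tendsto_mult_right) simp
  then show ?thesis
    by (rule LIMSEQ_le_const2) (use le in auto)
qed

section \<open>Comparison of the busy probabilities\<close>

theorem proposition3p23:
  fixes N i :: nat and B lam p :: real and l :: "real \<Rightarrow> real"
    and M :: "'w measure" and A :: "'w \<Rightarrow> real measure"
    and D :: "'w \<Rightarrow> (real \<times> real \<times> (nat \<Rightarrow> bool)) measure"
    and q :: "real \<Rightarrow> 'w \<Rightarrow> nat" and pi_MF2 :: "nat pmf"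
  assumes "N \<ge> 2" and "i \<in> {1..N}" and "B > 0" and "is_path_loss l"
    and "0 < lam" and "lam < mu_star B l N i"
    and "stationary_mf2 M lam B l N i p A D q pi_MF2"
  shows "measure_pmf.prob pi_MF2 {k. k > 0} \<le> measure_pmf.prob (pi_MF1 lam B l N i) {k. k > 0}"
proof -
  define x where "x = measure_pmf.prob (pi_MF1 lam B l N i) {k. k > 0}"
  have p: "p \<in> {0..1}" "p = measure_pmf.prob pi_MF2 {k. k > 0}"
    using assms(7) by (auto simp: stationary_mf2_def)
  have x: "0 < x" "x * capacity B (x * xi l N i) = lam"
    using busy_prob_MF1[OF assms(3-6)] by (simp_all add: x_def)
  have "xi l N i \<ge> 0"
    by (simp add: xi_def sum_nonneg path_loss_nonneg[OF assms(4)])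
  have "p * capacity B (p * xi l N i) \<le> p * (\<integral>\<theta>. service_rate B l N i \<theta> \<partial>bernoulli_field N i p)"
    using p(1) assms(3,4) by (intro mult_left_mono mean_service_rate_ge) auto
  also have "\<dots> \<le> lam"
    unfolding p(2) by (rule busy_prob_times_mean_rate_le) (use assms in \<open>auto simp: stationary_mf2_def p(2)[symmetric]\<close>)
  finally have "p \<le> x"
    using load_strict_mono[OF assms(3) \<open>xi l N i \<ge> 0\<close>, of x p] x by (cases "x < p") auto
  then show ?thesis
    by (simp add: x_def p(2)[symmetric])
qed

end
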